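(* Let $C\in\mathbb{R}^{m\times n}$ with $\operatorname{rank}(C)=c$ and $M\in\mathcal{M}_{m\times n}(\mathbb{R})$ with $\operatorname{rank}(M)=k$, and suppose $C=M+\sum_{i=1}^{c-k}\mathbf{r}_i\mathbf{c}_i^\mathsf{T}$ for some $\mathbf{r}_i\in\mathbb{R}^m$, $\mathbf{c}_i\in\mathbb{R}^n$. Then: (1) If $k=2$, then $\mathbf{1}_m\in\operatorname{span}(C)$ and $\mathbf{1}_n\in\operatorname{span}(C^\mathsf{T})$; moreover every $\mathbf{x}\in\mathbb{R}^n$ with $C\mathbf{x}=\mathbf{1}_m$ satisfies $\mathbf{1}_n^\mathsf{T}\mathbf{x}=0$, and every $\mathbf{y}\in\mathbb{R}^m$ with $C^\mathsf{T}\mathbf{y}=\mathbf{1}_n$ satisfies $\mathbf{1}_m^\mathsf{T}\mathbf{y}=0$. (2) If $k=1$, then $\mathbf{1}_m\in\operatorname{span}(C)$ or $\mathbf{1}_n\in\operatorname{span}(C^\mathsf{T})$ (or both).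
   Context: $\mathbf{1}_k$ is the all-ones vector of length $k$. $\operatorname{span}(C)$ denotes the column space of $C$. $\mathcal{M}_{m\times n}(\mathbb{R})=\{M\in\mathbb{R}^{m\times n}: M=\mathbf{1}_m\mathbf{u}^\mathsf{T}+\mathbf{v}\mathbf{1}_n^\mathsf{T}\text{ for some }\mathbf{u}\in\mathbb{R}^n,\mathbf{v}\in\mathbb{R}^m\}$. *)

theory Defs
  imports "HOL-Analysis.Analysis"
begin

text \<open>The all-ones vector.\<close>
definition ones :: "real^'k" where "ones = (\<chi> i. 1)"

text \<open>Rank-one matrix r c^T.\<close>
definition outer :: "real^'m \<Rightarrow> real^'n \<Rightarrow> real^'n^'m" where
  "outer r c = (\<chi> i j. r $ i * c $ j)"

text \<open>The set M_{m x n}(R) = { 1_m u^T + v 1_n^T }.\<close>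
definition Mset :: "(real^'n^'m) set" where
  "Mset = {M. \<exists>(u::real^'n) (v::real^'m). M = outer ones u + outer v ones}"

end

theory Submission
  imports Defs
begin

text \<open>A matrix \<open>M = 1 u\<^sup>T + v 1\<^sup>T\<close> has \<open>1\<close> in its column space unless \<open>u\<close> is parallel
  to \<open>1\<close>; in that case \<open>M = w 1\<^sup>T\<close>, so \<open>1\<close> lies in its row space. If \<open>rank M = 2\<close>, neither
  \<open>u\<close> nor \<open>v\<close> is parallel to \<open>1\<close>, and this forces \<open>1\<^sup>T x = 0\<close> whenever \<open>M x = 1\<close>.
  Adding \<open>c - k\<close> rank-one terms \<open>R\<close> can raise the rank to \<open>c\<close> only if the ranks of \<open>M\<close> and
  \<open>R\<close> add up, i.e. the column spaces of \<open>M\<close> and \<open>R\<close> are independent. Then the column space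
  of \<open>C = M + R\<close> contains that of \<open>M\<close>, and \<open>C x = 1\<close> already implies \<open>M x = 1\<close>. The
  same argument applies to the transposes.\<close>

lemma subspace_range_mult_vec: "subspace (range ((*v) (A :: real^'n^'m)))"
  by (simp add: linear_subspace_image)

lemma span_columns_eq_range: "span (columns (A :: real^'n^'m)) = range ((*v) A)"
proof
  show "range ((*v) A) \<subseteq> span (columns A)"
    using matrix_vector_mult_in_columnspace by blast
  have "columns A \<subseteq> range ((*v) A)"
    unfolding columns_image_basis by auto
  then show "span (columns A) \<subseteq> range ((*v) A)"
    by (rule span_minimal[OF _ subspace_range_mult_vec])
qed

lemma transpose_add: "transpose (A + B) = transpose A + (transpose B :: 'a::comm_ring_1^'n^'m)"
  by (simp add: transpose_def vec_eq_iff)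

lemma exists_orthogonal_not_orthogonal:
  fixes u w :: "'a::real_inner"
  assumes "u \<notin> span {w}"
  shows "\<exists>x. w \<bullet> x = 0 \<and> u \<bullet> x \<noteq> 0"
proof -
  define c where "c = (u \<bullet> w) / (w \<bullet> w)"
  define x where "x = u - c *\<^sub>R w"
  have wx: "w \<bullet> x = 0"
  proof (cases "w = 0")
    case False
    then have "c * (w \<bullet> w) = w \<bullet> u"
      by (simp add: c_def inner_commute[of u w])
    then show ?thesis
      by (simp add: x_def inner_diff_right)
  qed simp
  have "x \<bullet> x = u \<bullet> x - c * (w \<bullet> x)"
    by (subst (1) x_def) (simp add: inner_diff_left)
  then have "u \<bullet> x = x \<bullet> x"
    using wx by simp
  moreover have "x \<noteq> 0"
    using assms by (auto simp: x_def span_singleton)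
  ultimately show ?thesis
    using wx by auto
qed

lemma range_mult_vec_subset_and_disjoint_if_rank_add:
  fixes A B :: "real^'n^'m"
  assumes "rank A + rank B \<le> rank (A + B)"
  shows "range ((*v) A) \<subseteq> range ((*v) (A + B))"
    and "range ((*v) A) \<inter> range ((*v) B) = {0}"
proof -
  let ?S = "range ((*v) A)" and ?T = "range ((*v) B)"
  let ?U = "{x + y |x y. x \<in> ?S \<and> y \<in> ?T}"
  have "subspace ?U"
    by (intro subspace_sums subspace_range_mult_vec)
  have range_sum: "range ((*v) (A + B)) \<subseteq> ?U"
    by (auto simp: matrix_vector_mult_add_rdistrib)
  have "dim ?U + dim (?S \<inter> ?T) = dim ?S + dim ?T"
    by (intro dim_sums_Int subspace_range_mult_vec)
  moreover have "dim ?S + dim ?T \<le> dim (range ((*v) (A + B)))"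
    using assms by (simp add: rank_dim_range)
  moreover have "dim (range ((*v) (A + B))) \<le> dim ?U"
    using range_sum by (rule dim_subset)
  ultimately have "dim (?S \<inter> ?T) = 0" and "dim (range ((*v) (A + B))) = dim ?U"
    by linarith+
  have "0 \<in> ?S" "0 \<in> ?T"
    by (metis matrix_vector_mult_0_right rangeI)+
  have "range ((*v) (A + B)) = ?U"
    by (rule subspace_dim_equal[OF subspace_range_mult_vec \<open>subspace ?U\<close> range_sum])
      (use \<open>dim (range ((*v) (A + B))) = dim ?U\<close> in simp)
  moreover have "?S \<subseteq> ?U"
    using \<open>0 \<in> ?T\<close> by (metis (mono_tags, lifting) add.right_neutral mem_Collect_eq subsetI)
  ultimately show "?S \<subseteq> range ((*v) (A + B))"
    by simp
  show "?S \<inter> ?T = {0}"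
    using \<open>dim (?S \<inter> ?T) = 0\<close> \<open>0 \<in> ?S\<close> \<open>0 \<in> ?T\<close> by auto
qed

lemma mult_vec_eq_if_range_disjoint:
  fixes A B :: "real^'n^'m"
  assumes "range ((*v) A) \<inter> range ((*v) B) = {0}"
    and "(A + B) *v x \<in> range ((*v) A)"
  shows "A *v x = (A + B) *v x"
proof -
  have "B *v x = (A + B) *v x - A *v x"
    by (simp add: matrix_vector_mult_add_rdistrib)
  also have "\<dots> \<in> range ((*v) A)"
    using assms(2) by (intro subspace_diff subspace_range_mult_vec) auto
  finally have "B *v x = 0"
    using assms(1) by blast
  then show ?thesis
    by (simp add: matrix_vector_mult_add_rdistrib)
qed

lemma outer_mult_vec: "outer a b *v x = (b \<bullet> x) *\<^sub>R a"
  by (simp add: outer_def matrix_vector_mult_def inner_vec_def vec_eq_iff sum_distrib_left mult_ac)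

lemma transpose_outer: "transpose (outer a b) = outer b a"
  by (simp add: outer_def transpose_def vec_eq_iff mult_ac)

lemma rank_sum_outer_le:
  assumes "finite I"
  shows "rank (\<Sum>i\<in>I. outer (r i) (c i)) \<le> card I"
proof -
  have mult_vec: "(\<Sum>i\<in>I. outer (r i) (c i)) *v x = (\<Sum>i\<in>I. (c i \<bullet> x) *\<^sub>R r i)" for x
    using assms by (induction I rule: finite_induct)
      (auto simp: matrix_vector_mult_add_rdistrib outer_mult_vec)
  have "range ((*v) (\<Sum>i\<in>I. outer (r i) (c i))) \<subseteq> span (r ` I)"
    by (auto simp: mult_vec intro!: span_sum span_scale span_base[OF imageI])
  then have "rank (\<Sum>i\<in>I. outer (r i) (c i)) \<le> card (r ` I)"
    unfolding rank_dim_range using assms by (intro dim_le_card) auto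
  also have "\<dots> \<le> card I"
    using assms by (rule card_image_le)
  finally show ?thesis .
qed

lemma rank_outer_le_1: "rank (outer a b) \<le> 1"
  using rank_sum_outer_le[of "{()}" "\<lambda>_. a" "\<lambda>_. b"] by simp

lemma transpose_Mset:
  assumes "M \<in> Mset"
  shows "transpose M \<in> Mset"
proof -
  obtain u v where "M = outer ones u + outer v ones"
    using assms unfolding Mset_def by blast
  then have "transpose M = outer ones v + outer u ones"
    by (simp add: transpose_add transpose_outer add.commute)
  then show ?thesis
    unfolding Mset_def by blast
qed

lemma Mset_mult_vec:
  "(outer ones u + outer v ones) *v x = (u \<bullet> x) *\<^sub>R ones + (ones \<bullet> x) *\<^sub>R v"
  by (simp add: matrix_vector_mult_add_rdistrib outer_mult_vec)

lemma outer_ones_parallel_left: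
  "outer ones (a *\<^sub>R ones) + outer v ones = outer (a *\<^sub>R ones + v) ones"
  by (simp add: outer_def ones_def vec_eq_iff algebra_simps)

lemma outer_ones_parallel_right:
  "outer ones u + outer (b *\<^sub>R ones) ones = outer ones (u + b *\<^sub>R ones)"
  by (simp add: outer_def ones_def vec_eq_iff algebra_simps)

lemma ones_in_range_Mset:
  assumes "u \<notin> span {ones}"
  shows "ones \<in> range ((*v) (outer ones u + outer v ones))"
proof -
  obtain x where x: "ones \<bullet> x = 0" "u \<bullet> x \<noteq> 0"
    using exists_orthogonal_not_orthogonal[OF assms] by blast
  then have "(outer ones u + outer v ones) *v ((1 / (u \<bullet> x)) *\<^sub>R x) = ones"
    by (simp add: Mset_mult_vec)
  then show ?thesis
    by (metis rangeI)
qed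

lemma Mset_ones_in_range_or_transpose:
  assumes "M \<in> Mset" and "M \<noteq> 0"
  shows "ones \<in> range ((*v) M) \<or> ones \<in> range ((*v) (transpose M))"
proof -
  obtain u v where M: "M = outer ones u + outer v ones"
    using assms(1) unfolding Mset_def by blast
  show ?thesis
  proof (cases "u \<in> span {ones}")
    case True
    then obtain a where "u = a *\<^sub>R ones"
      by (auto simp: span_singleton)
    define w where "w = a *\<^sub>R ones + v"
    have "M = outer w ones"
      by (simp add: M w_def \<open>u = a *\<^sub>R ones\<close> outer_ones_parallel_left)
    then have "w \<noteq> 0"
      using assms(2) by (auto simp: outer_def vec_eq_iff)
    then have "transpose M *v ((1 / (w \<bullet> w)) *\<^sub>R w) = ones"
      by (simp add: \<open>M = outer w ones\<close> transpose_outer outer_mult_vec)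
    then show ?thesis
      by (metis rangeI)
  qed (simp add: M ones_in_range_Mset)
qed

lemma Mset_rank_2_ones_in_range:
  assumes "M \<in> Mset" and "rank M = 2"
  shows "ones \<in> range ((*v) M)"
proof -
  obtain u v where M: "M = outer ones u + outer v ones"
    using assms(1) unfolding Mset_def by blast
  have "u \<notin> span {ones}"
  proof
    assume "u \<in> span {ones}"
    then obtain a where "u = a *\<^sub>R ones"
      by (auto simp: span_singleton)
    then have "rank M \<le> 1"
      by (simp only: M outer_ones_parallel_left rank_outer_le_1)
    with assms(2) show False
      by simp
  qed
  then show ?thesis
    by (simp add: M ones_in_range_Mset)
qed

lemma Mset_rank_2_solution_orthogonal:
  assumes "M \<in> Mset" and "rank M = 2" and "M *v x = ones"
  shows "ones \<bullet> x = 0"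
proof (rule ccontr)
  assume "ones \<bullet> x \<noteq> 0"
  obtain u v where M: "M = outer ones u + outer v ones"
    using assms(1) unfolding Mset_def by blast
  have "(u \<bullet> x) *\<^sub>R ones + (ones \<bullet> x) *\<^sub>R v = ones"
    using assms(3) by (simp only: M Mset_mult_vec)
  then have "(ones \<bullet> x) *\<^sub>R v = (1 - u \<bullet> x) *\<^sub>R ones"
    by (metis add_diff_cancel_left' scaleR_diff_left scaleR_one)
  then have "v = ((1 - u \<bullet> x) / (ones \<bullet> x)) *\<^sub>R ones"
    using \<open>ones \<bullet> x \<noteq> 0\<close> by (metis scaleR_scaleR divide_inverse_commute left_inverse scaleR_one)
  then have "rank M \<le> 1"
    by (simp only: M outer_ones_parallel_right rank_outer_le_1)
  with assms(2) show False
    by simp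
qed

lemma rank_add_Mset_rank_2:
  assumes "M \<in> Mset" and "rank M = 2" and "rank M + rank R \<le> rank (M + R)"
  shows "ones \<in> range ((*v) (M + R))"
    and "(M + R) *v x = ones \<Longrightarrow> ones \<bullet> x = 0"
proof -
  have ones_M: "ones \<in> range ((*v) M)"
    using assms(1,2) by (rule Mset_rank_2_ones_in_range)
  note range_M = range_mult_vec_subset_and_disjoint_if_rank_add[OF assms(3)]
  show "ones \<in> range ((*v) (M + R))"
    using ones_M range_M(1) by (rule subsetD[rotated])
  assume solution: "(M + R) *v x = ones"
  have "M *v x = (M + R) *v x"
    using range_M(2) by (rule mult_vec_eq_if_range_disjoint) (simp only: solution ones_M)
  then have "M *v x = ones"
    by (simp only: solution)
  then show "ones \<bullet> x = 0"
    using assms(1,2) by (intro Mset_rank_2_solution_orthogonal)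
qed

theorem mainTheorem11:
  fixes C M :: "real^'n^'m" and c k :: nat
    and r :: "nat \<Rightarrow> real^'m" and cc :: "nat \<Rightarrow> real^'n"
  assumes "rank C = c"
    and "M \<in> Mset" and "rank M = k"
    and "C = M + (\<Sum>i\<in>{1..c-k}. outer (r i) (cc i))"
  shows "(k = 2 \<longrightarrow>
            ones \<in> span (columns C) \<and> ones \<in> span (columns (transpose C)) \<and>
            (\<forall>x. C *v x = ones \<longrightarrow> ones \<bullet> x = 0) \<and>
            (\<forall>y. transpose C *v y = ones \<longrightarrow> ones \<bullet> y = 0)) \<and>
         (k = 1 \<longrightarrow>
            ones \<in> span (columns C) \<or> ones \<in> span (columns (transpose C)))"
proof -
  define R where "R = (\<Sum>i\<in>{1..c-k}. outer (r i) (cc i))"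
  have C: "C = M + R"
    using assms(4) by (simp only: R_def)
  have C_transpose: "transpose C = transpose M + transpose R"
    unfolding C by (rule transpose_add)
  have rank_R: "rank R \<le> c - k"
    unfolding R_def using rank_sum_outer_le[of "{1..c-k}" r cc] by simp
  have "k \<le> c"
  proof (rule ccontr)
    assume "\<not> k \<le> c"
    then have "R = 0"
      using rank_R by (simp add: rank_eq_0)
    then show False
      using assms(1,3) C \<open>\<not> k \<le> c\<close> by simp
  qed
  then have rank_add: "rank M + rank R \<le> rank (M + R)"
    using assms(1,3) C rank_R by simp
  then have rank_add_transpose:
    "rank (transpose M) + rank (transpose R) \<le> rank (transpose M + transpose R)"
    by (simp only: rank_transpose flip: transpose_add)
  show ?thesis
    unfolding span_columns_eq_range C_transpose
  proof (intro conjI impI allI)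
    assume "k = 2"
    then have "rank M = 2" "rank (transpose M) = 2"
      using assms(3) by (simp_all add: rank_transpose)
    note column = rank_add_Mset_rank_2[OF assms(2) this(1) rank_add]
      and row = rank_add_Mset_rank_2[OF transpose_Mset[OF assms(2)] this(2) rank_add_transpose]
    show "ones \<in> range ((*v) C)" "\<And>x. C *v x = ones \<Longrightarrow> ones \<bullet> x = 0"
      using column by (simp_all only: C)
    show "ones \<in> range ((*v) (transpose M + transpose R))"
      "\<And>y. (transpose M + transpose R) *v y = ones \<Longrightarrow> ones \<bullet> y = 0"
      using row by simp_all
  next
    assume "k = 1"
    then have "M \<noteq> 0"
      using assms(3) by auto
    then show "ones \<in> range ((*v) C) \<or> ones \<in> range ((*v) (transpose M + transpose R))"
      using Mset_ones_in_range_or_transpose[OF assms(2)] C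
        range_mult_vec_subset_and_disjoint_if_rank_add(1)[OF rank_add]
        range_mult_vec_subset_and_disjoint_if_rank_add(1)[OF rank_add_transpose]
      by blast
  qed
qed

end
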